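(* Let $q,r$ be positive integers with $1<r$ and $r\mid q$, and let $G$ be the group of order $qr^2$ with presentation $$G=\langle a,b \mid a^{qr}=1=b^r,\ bab^{-1}=a^{q+1}\rangle.$$ Then $\mathcal{N}_G>0$ if either $\varphi(r)>4$, or $\varphi(r)=4$ and ($q$ is odd or $2r\mid q$).
   Context: $\varphi$ is the Euler function, $\varphi(n)=|(\mathbb{Z}/n)^\times|$. For a finite group $G$, two elements $g,h\in G$ are $\mathbb{R}$-$\mathrm{Aut}(G)$-conjugate if $g$ is in the $\mathrm{Aut}(G)$-orbit of $h$ or of $h^{-1}$; they are $\mathbb{Q}$-$\mathrm{Aut}(G)$-conjugate if the cyclic subgroups $\langle g\rangle$ and $\langle h\rangle$ are in the same $\mathrm{Aut}(G)$-orbit. Define $$\mathcal{N}_G = \#\{\mathbb{R}\text{-}\mathrm{Aut}(G)\text{-conjugacy classes in } G\} - \#\{\mathbb{Q}\text{-}\mathrm{Aut}(G)\text{-conjugacy classes in } G\}.$$ *)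

theory Defs
  imports "HOL-Algebra.Algebra" "HOL-Number_Theory.Totient"
begin

section \<open>Groups given by generators and relations\<close>

text \<open>
  A word over a set of generators is a list of letters; \<open>(x, True)\<close> stands for the
  generator \<open>x\<close> and \<open>(x, False)\<close> for its formal inverse.
  A set of relations is a set of pairs of words, \<open>(l, r)\<close> standing for \<open>l = r\<close>.
\<close>

type_synonym 'x word = "('x \<times> bool) list"

inductive_set word_cong :: "('x word \<times> 'x word) set \<Rightarrow> ('x word \<times> 'x word) set"
  for R :: "('x word \<times> 'x word) set"
where
  refl: "(u, u) \<in> word_cong R"
| sym: "(u, v) \<in> word_cong R \<Longrightarrow> (v, u) \<in> word_cong R"
| trans: "(u, v) \<in> word_cong R \<Longrightarrow> (v, w) \<in> word_cong R \<Longrightarrow> (u, w) \<in> word_cong R"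
| cancel: "(u @ [(x, s), (x, \<not> s)] @ v, u @ v) \<in> word_cong R"
| relation: "(l, r) \<in> R \<Longrightarrow> (u @ l @ v, u @ r @ v) \<in> word_cong R"

text \<open>The group with all elements of \<open>'x\<close> as generators and with relations \<open>R\<close>:
  words modulo \<^term>\<open>word_cong R\<close>, multiplied by concatenation. The union in the definition
  of the product is a union of copies of one and the same class.\<close>

definition presented_group :: "('x word \<times> 'x word) set \<Rightarrow> 'x word set monoid" where
  "presented_group R =
    \<lparr>carrier = UNIV // word_cong R,
     monoid.mult = (\<lambda>U V. \<Union>u\<in>U. \<Union>v\<in>V. word_cong R `` {u @ v}),
     one = word_cong R `` {[]}\<rparr>"

lemma equiv_word_cong: "equiv UNIV (word_cong R)"
proof (rule equivI)
  show "refl_on UNIV (word_cong R)" by (simp add: refl_on_def word_cong.refl)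
  show "sym (word_cong R)" by (rule symI) (rule word_cong.sym)
  show "trans (word_cong R)" by (rule transI) (rule word_cong.trans)
qed simp

lemma word_cong_append_left:
  "(u, v) \<in> word_cong R \<Longrightarrow> (w @ u, w @ v) \<in> word_cong R"
proof (induction rule: word_cong.induct)
  case (cancel u x s v)
  show ?case using word_cong.cancel[of "w @ u" x s v R] by simp
next
  case (relation l r u v)
  then show ?case using word_cong.relation[of l r R "w @ u" v] by simp
next
  case (trans u v w')
  show ?case by (rule word_cong.trans[OF trans.IH])
next
  case (sym u v)
  show ?case by (rule word_cong.sym[OF sym.IH])
qed (rule word_cong.refl)

lemma word_cong_append_right:
  "(u, v) \<in> word_cong R \<Longrightarrow> (u @ w, v @ w) \<in> word_cong R"
proof (induction rule: word_cong.induct)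
  case (cancel u x s v)
  show ?case using word_cong.cancel[of u x s "v @ w" R] by simp
next
  case (relation l r u v)
  then show ?case using word_cong.relation[of l r R u "v @ w"] by simp
next
  case (trans u v w')
  show ?case by (rule word_cong.trans[OF trans.IH])
next
  case (sym u v)
  show ?case by (rule word_cong.sym[OF sym.IH])
qed (rule word_cong.refl)

lemma presented_group_mult:
  "(word_cong R `` {u}) \<otimes>\<^bsub>presented_group R\<^esub> (word_cong R `` {v}) = word_cong R `` {u @ v}"
proof -
  have "word_cong R `` {u' @ v'} = word_cong R `` {u @ v}"
    if "(u, u') \<in> word_cong R" "(v, v') \<in> word_cong R" for u' v'
  proof -
    have "(u @ v, u' @ v') \<in> word_cong R"
      by (rule word_cong.trans[OF word_cong_append_right[OF that(1)] word_cong_append_left[OF that(2)]])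
    then show ?thesis
      using equiv_class_eq[OF equiv_word_cong] by metis
  qed
  then have "(\<Union>u'\<in>word_cong R `` {u}. \<Union>v'\<in>word_cong R `` {v}. word_cong R `` {u' @ v'})
      = (\<Union>u'\<in>word_cong R `` {u}. \<Union>v'\<in>word_cong R `` {v}. word_cong R `` {u @ v})"
    by (intro SUP_cong refl) (auto simp only: Image_singleton_iff)
  also have "\<dots> = word_cong R `` {u @ v}"
    using word_cong.refl[of u R] word_cong.refl[of v R] by blast
  finally show ?thesis
    by (simp add: presented_group_def)
qed

lemma word_cong_left_inverse:
  "(map (\<lambda>(x, s). (x, \<not> s)) (rev w) @ w, []) \<in> word_cong R"
proof (induction w)
  case (Cons p w)
  obtain x s where p: "p = (x, s)" by (cases p)
  show ?case
    using word_cong.trans[OF word_cong.cancel[of "map (\<lambda>(x, s). (x, \<not> s)) (rev w)" x "\<not> s" w R] Cons.IH]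
    by (simp add: p)
qed (simp add: word_cong.refl)

lemma group_presented_group: "group (presented_group R)"
proof (rule groupI)
  have carrier_iff:
    "U \<in> carrier (presented_group R) \<longleftrightarrow> (\<exists>u. U = word_cong R `` {u})" for U
    by (auto simp: presented_group_def quotient_def)
  have one: "\<one>\<^bsub>presented_group R\<^esub> = word_cong R `` {[]}"
    by (simp add: presented_group_def)
  note simps = carrier_iff one presented_group_mult
  show "\<one>\<^bsub>presented_group R\<^esub> \<in> carrier (presented_group R)"
    by (auto simp: simps)
  fix U assume U: "U \<in> carrier (presented_group R)"
  then show "\<one>\<^bsub>presented_group R\<^esub> \<otimes>\<^bsub>presented_group R\<^esub> U = U"
    by (auto simp only: simps append.simps)
  from U obtain u where u: "U = word_cong R `` {u}" by (auto simp: simps)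
  have "(word_cong R `` {map (\<lambda>(x, s). (x, \<not> s)) (rev u)}) \<otimes>\<^bsub>presented_group R\<^esub> U
      = \<one>\<^bsub>presented_group R\<^esub>"
    using equiv_class_eq[OF equiv_word_cong word_cong_left_inverse]
    by (simp only: u simps)
  then show "\<exists>V\<in>carrier (presented_group R).
      V \<otimes>\<^bsub>presented_group R\<^esub> U = \<one>\<^bsub>presented_group R\<^esub>"
    using carrier_iff by blast
  fix V assume V: "V \<in> carrier (presented_group R)"
  with U show "U \<otimes>\<^bsub>presented_group R\<^esub> V \<in> carrier (presented_group R)"
    by (auto simp only: simps)
  fix W assume "W \<in> carrier (presented_group R)"
  with U V show "U \<otimes>\<^bsub>presented_group R\<^esub> V \<otimes>\<^bsub>presented_group R\<^esub> W
      = U \<otimes>\<^bsub>presented_group R\<^esub> (V \<otimes>\<^bsub>presented_group R\<^esub> W)"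
    by (auto simp only: simps append_assoc)
qed

datatype gen = a | b

definition relations_qr :: "nat \<Rightarrow> nat \<Rightarrow> (gen word \<times> gen word) set" where
  "relations_qr q r =
    {(replicate (q * r) (a, True), []),
     (replicate r (b, True), []),
     ([(b, True), (a, True), (b, False)], replicate (q + 1) (a, True))}"

hide_const (open) a b


section \<open>Conjugacy up to automorphisms\<close>

definition R_Aut_conj :: "('g, 'm) monoid_scheme \<Rightarrow> ('g \<times> 'g) set" where
  "R_Aut_conj G = {(g, h). g \<in> carrier G \<and> h \<in> carrier G \<and>
     (g \<in> orbit (AutoGroup G) (\<lambda>f. f) h \<or> g \<in> orbit (AutoGroup G) (\<lambda>f. f) (inv\<^bsub>G\<^esub> h))}"

definition Q_Aut_conj :: "('g, 'm) monoid_scheme \<Rightarrow> ('g \<times> 'g) set" where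
  "Q_Aut_conj G = {(g, h). g \<in> carrier G \<and> h \<in> carrier G \<and>
     generate G {g} \<in> orbit (AutoGroup G) (\<lambda>f A. f ` A) (generate G {h})}"

text \<open>Only meaningful for finite groups, since \<^const>\<open>card\<close> sends infinite sets to 0.\<close>

definition N_Aut :: "('g, 'm) monoid_scheme \<Rightarrow> int" where
  "N_Aut G = int (card (carrier G // R_Aut_conj G)) - int (card (carrier G // Q_Aut_conj G))"

end

(*
  As q^2 is divisible by qr, the commutator z = a^q of b and a is central, of order r. Let f be an
  automorphism with f(b) = b^k. Comparing f(z), computed from z = a^q and from b a = z a b, gives
  k = 1 + t q(q-1)/2 modulo r for some t. So 2k = 2 modulo r, and even k = 1 modulo r if r divides
  q(q-1)/2. If phi(r) is large enough, some k prime to r is such that neither k nor -k satisfies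
  this; then b and b^k generate the same subgroup but are not R-Aut(G)-conjugate.
*)
theory Submission
  imports Defs
begin

section \<open>Counting the classes of a refinement\<close>

text \<open>Saturating by \<open>S\<close> maps the \<open>R\<close>-classes onto the
  \<open>S\<close>-classes. Were the counts equal, this surjection of finite sets would be
  injective, but it sends the distinct \<open>R\<close>-classes of \<open>x\<close> and
  \<open>y\<close> to one \<open>S\<close>-class.\<close>

lemma card_quotient_refinement_less:
  assumes "finite A" "equiv A R" "equiv A S" "R \<subseteq> S" and xy: "(x, y) \<in> S" "(x, y) \<notin> R"
  shows "card (A // S) < card (A // R)"
proof (rule ccontr)
  assume "\<not> card (A // S) < card (A // R)"
  have fin: "finite (A // R)"
    using assms(1,2) by (simp add: finite_quotient equiv_type)
  have img: "(\<lambda>C. S `` C) ` (A // R) = A // S"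
    by (rule refines_equiv_image_eq) fact+
  have "card (A // S) \<le> card (A // R)"
    by (rule finite_refines_card_le) fact+
  with \<open>\<not> card (A // S) < card (A // R)\<close> have "inj_on (\<lambda>C. S `` C) (A // R)"
    by (intro eq_card_imp_inj_on fin) (simp add: img)
  moreover have "x \<in> A" "y \<in> A"
    using xy assms(3) by (auto simp: equiv_def)
  moreover have "S `` (R `` {x}) = S `` (R `` {y})"
    using refines_equiv_class_eq2[OF assms(4,2,3)] equiv_class_eq[OF assms(3) xy(1)] by simp
  ultimately have "R `` {x} = R `` {y}"
    by (meson inj_onD quotientI)
  then show False
    using xy(2) eq_equiv_class[OF _ assms(2) \<open>y \<in> A\<close>] by blast
qed


section \<open>Orbits of automorphisms\<close>

lemma autoD:
  assumes "f \<in> auto G"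
  shows "f \<in> hom G G" "bij_betw f (carrier G) (carrier G)"
  using assms by (auto simp: auto_def Bij_def)

context group
begin

text \<open>Members of \<open>auto G\<close> are extensional on the carrier, so composites and
  inverses have to be taken in restricted form.\<close>

lemma auto_compose:
  assumes "f \<in> auto G" "g \<in> auto G"
  shows "compose (carrier G) f g \<in> auto G"
proof -
  have "compose (carrier G) f g \<in> hom G G"
    using assms by (intro hom_compose) (auto simp: auto_def)
  then show ?thesis
    using assms by (simp add: auto_def compose_Bij)
qed

lemma auto_inverse:
  assumes "f \<in> auto G"
  obtains g where "g \<in> auto G" "\<And>x. x \<in> carrier G \<Longrightarrow> g (f x) = x"
proof
  show "restrict (inv_into (carrier G) f) (carrier G) \<in> auto G"
    using assms restrict_inv_into_hom restrict_inv_into_Bij by (auto simp: auto_def)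
  show "restrict (inv_into (carrier G) f) (carrier G) (f x) = x" if "x \<in> carrier G" for x
    using autoD(2)[OF assms] that by (auto simp: bij_betw_def)
qed

lemma auto_closed: "f \<in> auto G \<Longrightarrow> x \<in> carrier G \<Longrightarrow> f x \<in> carrier G"
  by (auto dest!: autoD(1) simp: hom_def)

lemma auto_group_hom: "f \<in> auto G \<Longrightarrow> group_hom G G f"
  by (simp add: autoD(1) group_hom_axioms_def group_hom_def is_group)

lemma auto_inv: "f \<in> auto G \<Longrightarrow> x \<in> carrier G \<Longrightarrow> f (inv x) = inv (f x)"
  using auto_group_hom group_hom.hom_inv by fastforce

lemma auto_generate: "f \<in> auto G \<Longrightarrow> K \<subseteq> carrier G \<Longrightarrow> f ` generate G K = generate G (f ` K)"
  using auto_group_hom group_hom.generate_img by fastforce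

lemma R_Aut_conj_iff:
  "(g, h) \<in> R_Aut_conj G \<longleftrightarrow>
    g \<in> carrier G \<and> h \<in> carrier G \<and> (\<exists>f\<in>auto G. g = f h \<or> g = f (inv h))"
  by (auto simp: R_Aut_conj_def orbit_def AutoGroup_def)

text \<open>An automorphism maps the subgroup generated by \<open>h\<close> onto the one generated
  by \<open>f h\<close>; the orbit of subgroups thus becomes a condition on elements.\<close>

lemma Q_Aut_conj_iff:
  "(g, h) \<in> Q_Aut_conj G \<longleftrightarrow>
    g \<in> carrier G \<and> h \<in> carrier G \<and> (\<exists>f\<in>auto G. generate G {g} = generate G {f h})"
proof -
  have "f ` generate G {h} = generate G {f h}" if "f \<in> auto G" "h \<in> carrier G" for f
    using auto_generate[of f "{h}"] that by simp
  moreover have "(g, h) \<in> Q_Aut_conj G \<longleftrightarrow>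
      g \<in> carrier G \<and> h \<in> carrier G \<and> (\<exists>f\<in>auto G. generate G {g} = f ` generate G {h})"
    by (auto simp: Q_Aut_conj_def orbit_def AutoGroup_def)
  ultimately show ?thesis
    by (simp cong: conj_cong bex_cong)
qed

text \<open>Automorphisms commute with inversion, so a sign can be moved to the other side
  (symmetry), and two signs combine into one (transitivity).\<close>

lemma equiv_R_Aut_conj: "equiv (carrier G) (R_Aut_conj G)"
proof (rule equivI)
  show "R_Aut_conj G \<subseteq> carrier G \<times> carrier G"
    by (auto simp: R_Aut_conj_iff)
  have id: "\<exists>f\<in>auto G. f g = g" if "g \<in> carrier G" for g
    by (rule bexI[OF _ id_in_auto]) (simp add: that)
  show "refl_on (carrier G) (R_Aut_conj G)"
    unfolding refl_on_def R_Aut_conj_iff by (metis id)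
  show "sym (R_Aut_conj G)"
  proof (rule symI)
    fix g h assume "(g, h) \<in> R_Aut_conj G"
    then obtain f where f: "f \<in> auto G" "g = f h \<or> g = f (inv h)"
      and gh: "g \<in> carrier G" "h \<in> carrier G"
      by (auto simp: R_Aut_conj_iff)
    obtain f' where f': "f' \<in> auto G" "\<And>x. x \<in> carrier G \<Longrightarrow> f' (f x) = x"
      using auto_inverse[OF f(1)] by blast
    have "h = f' g \<or> h = f' (inv g)"
    proof (cases "g = f h")
      case True
      then show ?thesis
        using f'(2) gh by simp
    next
      case False
      then have "inv g = f h"
        using f gh by (simp add: auto_inv auto_closed)
      then show ?thesis
        using f'(2) gh by simp
    qed
    then show "(h, g) \<in> R_Aut_conj G"
      using f'(1) gh by (auto simp: R_Aut_conj_iff)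
  qed
  show "trans (R_Aut_conj G)"
  proof (rule transI)
    fix g h k assume "(g, h) \<in> R_Aut_conj G" "(h, k) \<in> R_Aut_conj G"
    then obtain f f' where f: "f \<in> auto G" "g = f h \<or> g = f (inv h)"
      and f': "f' \<in> auto G" "h = f' k \<or> h = f' (inv k)"
      and c: "g \<in> carrier G" "h \<in> carrier G" "k \<in> carrier G"
      by (auto simp: R_Aut_conj_iff)
    have "g = compose (carrier G) f f' k \<or> g = compose (carrier G) f f' (inv k)"
    proof (cases "g = f h")
      case True
      then show ?thesis
        using f'(2) c by (auto simp: compose_def)
    next
      case False
      then have "g = f (inv h)"
        using f(2) by simp
      moreover have "inv h = f' k \<or> inv h = f' (inv k)"
        using f'(2) c by (auto simp: auto_inv[OF f'(1)] auto_closed[OF f'(1)])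
      ultimately show ?thesis
        using c by (auto simp: compose_def)
    qed
    then show "(g, k) \<in> R_Aut_conj G"
      using c auto_compose[OF f(1) f'(1)] by (auto simp: R_Aut_conj_iff)
  qed
qed

lemma equiv_Q_Aut_conj: "equiv (carrier G) (Q_Aut_conj G)"
proof (rule equivI)
  have img: "f ` generate G {g} = generate G {f g}" if "f \<in> auto G" "g \<in> carrier G" for f g
    using auto_generate[of f "{g}"] that by simp
  show "Q_Aut_conj G \<subseteq> carrier G \<times> carrier G"
    by (auto simp: Q_Aut_conj_iff)
  have id: "\<exists>f\<in>auto G. f g = g" if "g \<in> carrier G" for g
    by (rule bexI[OF _ id_in_auto]) (simp add: that)
  show "refl_on (carrier G) (Q_Aut_conj G)"
    unfolding refl_on_def Q_Aut_conj_iff by (metis id)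
  show "sym (Q_Aut_conj G)"
  proof (rule symI)
    fix g h assume "(g, h) \<in> Q_Aut_conj G"
    then obtain f where f: "f \<in> auto G" "generate G {g} = generate G {f h}"
      and gh: "g \<in> carrier G" "h \<in> carrier G"
      by (auto simp: Q_Aut_conj_iff)
    obtain f' where f': "f' \<in> auto G" "\<And>x. x \<in> carrier G \<Longrightarrow> f' (f x) = x"
      using auto_inverse[OF f(1)] by blast
    have "generate G {h} = f' ` generate G {f h}"
      using f' gh by (simp add: img auto_closed[OF f(1)])
    also have "\<dots> = generate G {f' g}"
      using f' gh by (simp add: img flip: f(2))
    finally show "(h, g) \<in> Q_Aut_conj G"
      using f'(1) gh by (auto simp: Q_Aut_conj_iff)
  qed
  show "trans (Q_Aut_conj G)"
  proof (rule transI)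
    fix g h k assume "(g, h) \<in> Q_Aut_conj G" "(h, k) \<in> Q_Aut_conj G"
    then obtain f f' where f: "f \<in> auto G" "generate G {g} = generate G {f h}"
      and f': "f' \<in> auto G" "generate G {h} = generate G {f' k}"
      and c: "g \<in> carrier G" "h \<in> carrier G" "k \<in> carrier G"
      by (auto simp: Q_Aut_conj_iff)
    have "generate G {g} = f ` generate G {h}"
      using f c by (simp add: img)
    also have "\<dots> = generate G {f (f' k)}"
      using f f' c by (simp add: img auto_closed)
    finally have "generate G {g} = generate G {compose (carrier G) f f' k}"
      using c by (simp add: compose_def)
    then show "(g, k) \<in> Q_Aut_conj G"
      using c auto_compose[OF f(1) f'(1)] by (auto simp: Q_Aut_conj_iff)
  qed
qed

lemma generate_inv:
  assumes "g \<in> carrier G"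
  shows "generate G {inv g} = generate G {g}"
proof
  have "generate G {inv h} \<subseteq> generate G {h}" if "h \<in> carrier G" for h
    using that by (intro generate_subgroup_incl generate_is_subgroup) (auto intro: generate.inv)
  from this[of g] this[of "inv g"] assms
  show "generate G {inv g} \<subseteq> generate G {g}" "generate G {g} \<subseteq> generate G {inv g}"
    by auto
qed

text \<open>An element and its inverse generate the same cyclic subgroup, so allowing inverses does
  not leave the coarser relation.\<close>

lemma R_Aut_conj_subset_Q_Aut_conj: "R_Aut_conj G \<subseteq> Q_Aut_conj G"
  by (fastforce simp: R_Aut_conj_iff Q_Aut_conj_iff auto_inv generate_inv auto_closed)

text \<open>This reduces positivity to one separating pair, which will be \<open>y [^] k\<close> and
  \<open>y\<close> for a suitable \<open>k\<close>.\<close>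

lemma N_Aut_pos:
  assumes "finite (carrier G)" "(g, h) \<in> Q_Aut_conj G" "(g, h) \<notin> R_Aut_conj G"
  shows "N_Aut G > 0"
  unfolding N_Aut_def
  using card_quotient_refinement_less[OF assms(1) equiv_R_Aut_conj equiv_Q_Aut_conj
      R_Aut_conj_subset_Q_Aut_conj assms(2,3)] by simp

section \<open>Powers, and products of powers with a central commutator\<close>

lemma pow_cong:
  assumes "g \<in> carrier G" "g [^] (r::nat) = \<one>" "[m = n] (mod r)"
  shows "g [^] m = g [^] n"
proof -
  have "g [^] n = g [^] (n mod r)" for n
  proof -
    have "g [^] n = g [^] (r * (n div r)) \<otimes> g [^] (n mod r)"
      using assms(1) by (simp add: nat_pow_mult)
    then show ?thesis
      using assms(1,2) by (simp add: nat_pow_pow[symmetric])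
  qed
  then show ?thesis
    using assms(3) by (metis cong_def)
qed

text \<open>With \<open>m\<close> inverse to \<open>k\<close> modulo \<open>r\<close>, the
  \<open>m\<close>-th power undoes the \<open>k\<close>-th.\<close>

lemma generate_coprime_pow:
  assumes y: "y \<in> carrier G" "y [^] r = \<one>" and "coprime k (r::nat)"
  shows "generate G {y [^] k} = generate G {y}"
proof
  have pow: "g [^] n \<in> generate G {g}" if "g \<in> carrier G" for g and n :: nat
    using that by (induction n) (auto intro: generate.intros)
  show "generate G {y [^] k} \<subseteq> generate G {y}"
    using y by (intro generate_subgroup_incl generate_is_subgroup) (auto intro: pow)
  obtain m where "[k * m = 1] (mod r)"
    using cong_solve_coprime_nat[OF assms(3)] by auto
  then have "y [^] (k * m) = y [^] (1::nat)"
    by (rule pow_cong[OF y])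
  then have "(y [^] k) [^] m = y"
    using y(1) by (simp add: nat_pow_pow)
  then show "generate G {y} \<subseteq> generate G {y [^] k}"
    using y pow[of "y [^] k" m] by (intro generate_subgroup_incl generate_is_subgroup) auto
qed

lemma commute_pow_pow:
  fixes m n :: nat
  assumes "x \<otimes> y = y \<otimes> x" "x \<in> carrier G" "y \<in> carrier G"
  shows "x [^] m \<otimes> y [^] n = y [^] n \<otimes> x [^] m"
  by (metis assms group_commutes_pow nat_pow_closed)

text \<open>Conjugation by \<open>y\<close> is multiplicative; written without inverses,
  \<open>y\<close> moves past one factor \<open>x\<close> at a time and turns it into
  \<open>w\<close>.\<close>

lemma intertwine_pow:
  fixes n :: nat
  assumes "x \<in> carrier G" "y \<in> carrier G" "w \<in> carrier G" "y \<otimes> x = w \<otimes> y"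
  shows "y \<otimes> x [^] n = w [^] n \<otimes> y"
proof (induction n)
  case (Suc n)
  have "y \<otimes> x [^] Suc n = w [^] n \<otimes> (y \<otimes> x)"
    using assms(1-3) Suc.IH by (simp add: m_assoc[symmetric])
  also have "\<dots> = w [^] Suc n \<otimes> y"
    using assms by (simp add: m_assoc)
  finally show ?case .
qed (use assms in simp)

text \<open>Each passage of a \<open>y\<close> across an \<open>x\<close> leaves one factor
  \<open>z\<close>, which commutes with both and can be moved to the front. There are
  \<open>i * j\<close> passages.\<close>

lemma pow_commutation:
  fixes i j :: nat
  assumes c: "x \<in> carrier G" "y \<in> carrier G" "z \<in> carrier G"
    and zx: "z \<otimes> x = x \<otimes> z" and zy: "z \<otimes> y = y \<otimes> z" and yx: "y \<otimes> x = z \<otimes> x \<otimes> y"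
  shows "y [^] j \<otimes> x [^] i = z [^] (i * j) \<otimes> x [^] i \<otimes> y [^] j"
proof -
  have *: "y \<otimes> x [^] i = z [^] i \<otimes> x [^] i \<otimes> y"
    using intertwine_pow[of x y "z \<otimes> x" i] pow_mult_distrib[OF zx, of i] c yx by simp
  have zyj: "y [^] n \<otimes> z [^] m = z [^] m \<otimes> y [^] n" for n m :: nat
    by (rule commute_pow_pow) (use c zy in auto)
  show ?thesis
  proof (induction j)
    case (Suc j)
    have "y [^] Suc j \<otimes> x [^] i = y [^] j \<otimes> z [^] i \<otimes> x [^] i \<otimes> y"
      using c * by (simp add: m_assoc)
    also have "\<dots> = z [^] i \<otimes> (y [^] j \<otimes> x [^] i) \<otimes> y"
      using c by (simp add: zyj m_assoc)
    also have "\<dots> = (z [^] i \<otimes> z [^] (i * j)) \<otimes> x [^] i \<otimes> y [^] Suc j"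
      using c Suc.IH by (simp add: m_assoc)
    finally show ?case
      using c by (simp add: nat_pow_mult)
  qed (use c in simp)
qed

text \<open>The power formula for nilpotency class 2. Appending a factor to the \<open>n\<close>-th
  power moves \<open>y [^] (j * n)\<close> across \<open>x [^] i\<close>, at the cost of
  \<open>i * j * n\<close> factors \<open>z\<close>; summing these costs gives the binomial
  coefficient.\<close>

lemma pow_mult_central_commutator:
  fixes i j n :: nat
  assumes c: "x \<in> carrier G" "y \<in> carrier G" "z \<in> carrier G"
    and zx: "z \<otimes> x = x \<otimes> z" and zy: "z \<otimes> y = y \<otimes> z" and yx: "y \<otimes> x = z \<otimes> x \<otimes> y"
  shows "(x [^] i \<otimes> y [^] j) [^] n
    = z [^] (i * j * (n choose 2)) \<otimes> x [^] (i * n) \<otimes> y [^] (j * n)"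
proof (induction n)
  case (Suc n)
  let ?e = "i * j * (n choose 2)"
  have zxj: "x [^] n \<otimes> z [^] m = z [^] m \<otimes> x [^] n" for n m :: nat
    by (rule commute_pow_pow) (use c zx in auto)
  have "(x [^] i \<otimes> y [^] j) [^] Suc n
      = z [^] ?e \<otimes> x [^] (i * n) \<otimes> (y [^] (j * n) \<otimes> x [^] i) \<otimes> y [^] j"
    using c Suc.IH by (simp add: m_assoc)
  also have "\<dots> = z [^] ?e \<otimes> (x [^] (i * n) \<otimes> z [^] (i * (j * n))) \<otimes> x [^] i
      \<otimes> (y [^] (j * n) \<otimes> y [^] j)"
    using c by (simp add: pow_commutation[OF assms] m_assoc)
  also have "\<dots> = (z [^] ?e \<otimes> z [^] (i * (j * n))) \<otimes> (x [^] (i * n) \<otimes> x [^] i)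
      \<otimes> (y [^] (j * n) \<otimes> y [^] j)"
    using c by (simp add: zxj m_assoc)
  also have "\<dots> = z [^] (?e + i * (j * n)) \<otimes> x [^] (i * n + i) \<otimes> y [^] (j * n + j)"
    using c by (simp add: nat_pow_mult)
  also have "?e + i * (j * n) = i * j * (Suc n choose 2)"
    by (simp add: numeral_2_eq_2 distrib_left ac_simps)
  finally show ?case
    by (simp add: add.commute)
qed (use c in \<open>simp add: numeral_2_eq_2\<close>)

end


section \<open>The group $G$\<close>

text \<open>The conjugation relation is stated without inverses and with
  \<open>x [^] (q + 1)\<close> split, so that \<open>x [^] q\<close> appears as the commutator of
  \<open>y\<close> and \<open>x\<close>. The relations only bound the order from above; fixing it
  makes the normal forms below distinct.\<close>

locale qr_group = group +
  fixes q r :: nat and x y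
  assumes q_pos: "0 < q" and r_dvd_q: "r dvd q"
    and x: "x \<in> carrier G" and y: "y \<in> carrier G"
    and x_pow: "x [^] (q * r) = \<one>" and y_pow: "y [^] r = \<one>"
    and yx: "y \<otimes> x = x [^] q \<otimes> x \<otimes> y"
    and generated: "generate G {x, y} = carrier G"
    and order: "order G = q * r\<^sup>2"
begin

abbreviation "z \<equiv> x [^] q"

lemma r_pos: "0 < r"
  using r_dvd_q q_pos by (cases r) auto

lemma z: "z \<in> carrier G"
  using x by simp

lemma zx: "z \<otimes> x = x \<otimes> z"
  using x nat_pow_mult[of x q 1] nat_pow_mult[of x 1 q] by simp

lemma z_pow: "z [^] r = \<one>"
  using x x_pow by (simp add: nat_pow_pow)

text \<open>Conjugation by \<open>y\<close> takes \<open>x\<close> to \<open>z \<otimes> x\<close>,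
  hence \<open>z\<close> to \<open>z [^] q \<otimes> z\<close>, and \<open>z [^] q\<close> is
  trivial because \<open>r\<close> divides \<open>q\<close>.\<close>

lemma zy: "z \<otimes> y = y \<otimes> z"
proof -
  have "y \<otimes> z = z [^] q \<otimes> z \<otimes> y"
    using intertwine_pow[of x y "z \<otimes> x" q] pow_mult_distrib[OF zx z x, of q] x y yx by simp
  moreover have "z [^] q = \<one>"
    using pow_cong[OF z z_pow, of q 0] r_dvd_q by (simp add: cong_0_iff)
  ultimately show ?thesis
    using x y by simp
qed

lemmas commutation = pow_commutation[OF x y z zx zy yx]
lemmas pow_normal_form = pow_mult_central_commutator[OF x y z zx zy yx]

text \<open>Moving powers of \<open>x\<close> to the left only creates powers of \<open>z\<close>,
  which are powers of \<open>x\<close> again. So the normal forms are closed under products, and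
  they contain the generators and their inverses.\<close>

lemma carrier_normal_form:
  "carrier G = (\<lambda>(i, j). x [^] i \<otimes> y [^] j) ` ({..<q * r} \<times> {..<r})"
proof
  let ?S = "(\<lambda>(i, j). x [^] i \<otimes> y [^] j) ` ({..<q * r} \<times> {..<r})"
  have S: "x [^] i \<otimes> y [^] j \<in> ?S" for i j :: nat
  proof -
    have "x [^] i = x [^] (i mod (q * r))" "y [^] j = y [^] (j mod r)"
      by (rule pow_cong[OF x x_pow] pow_cong[OF y y_pow], simp)+
    then show ?thesis
      using q_pos r_pos by (intro image_eqI[of _ _ "(i mod (q * r), j mod r)"]) auto
  qed
  have mult: "(x [^] i \<otimes> y [^] j) \<otimes> (x [^] i' \<otimes> y [^] j') \<in> ?S" for i j i' j' :: nat
  proof -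
    have "(x [^] i \<otimes> y [^] j) \<otimes> (x [^] i' \<otimes> y [^] j')
        = x [^] i \<otimes> (y [^] j \<otimes> x [^] i') \<otimes> y [^] j'"
      using x y by (simp add: m_assoc)
    also have "\<dots> = (x [^] i \<otimes> x [^] (q * (i' * j)) \<otimes> x [^] i') \<otimes> (y [^] j \<otimes> y [^] j')"
      using x y by (simp add: commutation m_assoc nat_pow_pow)
    also have "\<dots> = x [^] (i + q * (i' * j) + i') \<otimes> y [^] (j + j')"
      using x y by (simp add: nat_pow_mult)
    finally show ?thesis
      by (simp only: S)
  qed
  \<comment> \<open>Exponents are natural numbers, so inverses are written as positive-order powers:
    \<open>q * r\<close> and \<open>r\<close> are positive, hence subtracting 1 is not
    truncated.\<close>
  have inv_xy: "inv x = x [^] (q * r - 1) \<otimes> y [^] (0::nat)" "inv y = x [^] (0::nat) \<otimes> y [^] (r - 1)"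
  proof -
    have "x [^] (q * r - 1) \<otimes> x = \<one>" "y [^] (r - 1) \<otimes> y = \<one>"
      using nat_pow_Suc[of x "q * r - 1"] nat_pow_Suc[of y "r - 1"] q_pos r_pos x_pow y_pow
      by simp_all
    then show "inv x = x [^] (q * r - 1) \<otimes> y [^] (0::nat)"
        "inv y = x [^] (0::nat) \<otimes> y [^] (r - 1)"
      using x y inv_equality by auto
  qed
  have "g \<in> ?S" if "g \<in> generate G {x, y}" for g
    using that
  proof induction
    case one
    then show ?case using S[of 0 0] by simp
  next
    case (incl h)
    moreover have "x \<in> ?S" "y \<in> ?S"
      using S[of 1 0] S[of 0 1] x y by simp_all
    ultimately show ?case
      by blast
  next
    case (inv h)
    then consider "h = x" | "h = y" by blast
    then show ?case by cases (simp_all only: inv_xy S)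
  next
    case (eng g h)
    obtain p where "g = (case p of (i, j) \<Rightarrow> x [^] (i::nat) \<otimes> y [^] (j::nat))"
      using eng.IH(1) by (rule imageE)
    moreover obtain p' where "h = (case p' of (i, j) \<Rightarrow> x [^] (i::nat) \<otimes> y [^] (j::nat))"
      using eng.IH(2) by (rule imageE)
    ultimately show ?case
      by (cases p, cases p') (simp only: prod.case mult)
  qed
  then show "carrier G \<subseteq> ?S"
    using generated by blast
  show "?S \<subseteq> carrier G"
    using x y by auto
qed

lemma normal_form:
  assumes "g \<in> carrier G"
  obtains s t :: nat where "g = x [^] s \<otimes> y [^] t"
  using assms by (subst (asm) carrier_normal_form) auto

text \<open>There are \<open>q * r * r\<close> pairs of exponents, as many as group elements, so the
  surjection onto the carrier is injective.\<close>

lemma inj_on_normal_form: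
  "inj_on (\<lambda>(i, j). x [^] (i::nat) \<otimes> y [^] (j::nat)) ({..<q * r} \<times> {..<r})"
  by (rule eq_card_imp_inj_on)
    (use order in \<open>simp_all add: carrier_normal_form[symmetric] order_def power2_eq_square\<close>)

lemma ord_z: "ord z = r"
proof (subst ord_unique[OF z], intro allI iffI)
  fix n :: nat
  assume n: "z [^] n = \<one>"
  \<comment> \<open>Reducing \<open>n\<close> modulo \<open>r\<close> keeps the exponent below
    \<open>q * r\<close>, where normal forms are unique.\<close>
  have "x [^] (q * (n mod r)) \<otimes> y [^] (0::nat) = x [^] (0::nat) \<otimes> y [^] (0::nat)"
    using n x pow_cong[OF z z_pow, of n "n mod r"] by (simp add: nat_pow_pow[symmetric])
  then have "q * (n mod r) = 0"
    using inj_onD[OF inj_on_normal_form, of "(q * (n mod r), 0)" "(0, 0)"] q_pos r_pos by simp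
  then show "r dvd n"
    using q_pos by (simp add: dvd_eq_mod_eq_0)
next
  fix n :: nat
  assume "r dvd n"
  then show "z [^] n = \<one>"
    using pow_cong[OF z z_pow, of n 0] by (simp add: cong_0_iff)
qed

lemma z_pow_eq_iff: "z [^] m = z [^] n \<longleftrightarrow> [m = n] (mod r)" for m n :: nat
proof
  have *: "[m = n] (mod r)" if "z [^] m = z [^] n" "n \<le> m" for m n :: nat
  proof -
    have "z [^] (m - n) = \<one>"
      by (rule pow_eq_div2[OF z that(1)])
    then have "r dvd m - n"
      using pow_eq_id[OF z] ord_z by simp
    then show ?thesis
      using that(2) by (simp add: cong_def mod_eq_dvd_iff_nat)
  qed
  show "[m = n] (mod r)" if "z [^] m = z [^] n"
    using *[OF that] *[OF that[symmetric], THEN cong_sym] by linarith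
qed (rule pow_cong[OF z z_pow])

text \<open>
  Write $f(x) = x^s y^t$. Applying $f$ to $yx = zxy$ gives $f(z) = z^{sk}$, while
  $f(z) = f(x)^q = z^{s(1 + t q(q-1)/2)}$. As $f(z)$ has order $r$, the factor $s$ can be cancelled.
\<close>

lemma auto_pow_cong:
  assumes f: "f \<in> auto G" and fy: "f y = y [^] (k::nat)"
  shows "\<exists>t. [k = 1 + t * (q choose 2)] (mod r)"
proof -
  interpret f: group_hom G G f
    using auto_group_hom[OF f] .
  obtain s t :: nat where fx: "f x = x [^] s \<otimes> y [^] t"
    using normal_form[OF auto_closed[OF f x]] .
  have "f z = (x [^] s \<otimes> y [^] t) [^] q"
    using x by (simp add: f.hom_nat_pow fx)
  also have "\<dots> = z [^] (s * t * (q choose 2)) \<otimes> z [^] s \<otimes> y [^] (t * q)"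
    using x by (simp add: pow_normal_form nat_pow_pow mult.commute)
  also have "y [^] (t * q) = \<one>"
    using pow_cong[OF y y_pow, of "t * q" 0] r_dvd_q by (simp add: cong_0_iff)
  finally have fz1: "f z = z [^] (s * (1 + t * (q choose 2)))"
    using x by (simp add: nat_pow_mult distrib_left ac_simps)
  have "f z \<otimes> (f x \<otimes> f y) = f (z \<otimes> x \<otimes> y)"
    using x y by (simp add: m_assoc)
  also have "\<dots> = f y \<otimes> f x"
    using f.hom_mult[OF y x] by (simp only: yx)
  also have "\<dots> = (y [^] k \<otimes> x [^] s) \<otimes> y [^] t"
    using x y by (simp add: fx fy m_assoc)
  also have "\<dots> = z [^] (s * k) \<otimes> x [^] s \<otimes> (y [^] k \<otimes> y [^] t)"
    using x y by (simp add: commutation m_assoc)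
  also have "y [^] k \<otimes> y [^] t = y [^] t \<otimes> y [^] k"
    by (rule nat_pow_comm[OF y])
  finally have "f z \<otimes> (f x \<otimes> f y) = z [^] (s * k) \<otimes> (f x \<otimes> f y)"
    using x y by (simp add: fx fy m_assoc)
  then have fz2: "f z = z [^] (s * k)"
    using x y by simp
  have "coprime s r"
  proof (rule coprimeI)
    fix d assume d: "d dvd s" "d dvd r"
    obtain m where m: "s = d * m"
      using d(1) ..
    obtain n where n: "r = d * n"
      using d(2) ..
    \<comment> \<open>Here \<open>n\<close> is \<open>r\<close> divided by \<open>d\<close>, and
      \<open>s * n\<close> is a multiple of \<open>r\<close>. So \<open>f\<close> kills
      \<open>z [^] n\<close>, and injectivity with \<open>ord_z\<close> leaves only a unit for
      \<open>d\<close>.\<close>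
    have "f (z [^] n) = z [^] (s * k * n)"
      unfolding f.hom_nat_pow[OF z] fz2 by (rule nat_pow_pow[OF z])
    also have "\<dots> = z [^] (0::nat)"
      unfolding z_pow_eq_iff by (simp add: m n cong_0_iff ac_simps)
    finally have "f (z [^] n) = f \<one>" by simp
    then have "z [^] n = \<one>"
      using bij_betw_imp_inj_on[OF autoD(2)[OF f]] x by (simp only: inj_on_eq_iff nat_pow_closed one_closed)
    then have "r dvd n"
      using pow_eq_id[OF z] ord_z by simp
    then have "d * n dvd 1 * n"
      using n by simp
    then show "is_unit d"
      using n r_pos by (subst (asm) dvd_times_right_cancel_iff) auto
  qed
  moreover have "[s * k = s * (1 + t * (q choose 2))] (mod r)"
    using fz1 fz2 z_pow_eq_iff by simp
  ultimately show ?thesis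
    using cong_mult_lcancel_nat by blast
qed

text \<open>The identity automorphism shows that \<open>y [^] k\<close> and \<open>y\<close> are
  Q-conjugate. R-conjugacy would need an automorphism sending \<open>y\<close> to its power with
  exponent \<open>k\<close> or \<open>-k\<close>, and \<open>r - k\<close> represents the latter;
  \<open>auto_pow_cong\<close> excludes both.\<close>

lemma N_Aut_pos_if:
  assumes k: "coprime k r" "k < r"
    and no_cong: "\<And>t. \<not> [k = 1 + t * (q choose 2)] (mod r)"
      "\<And>t. \<not> [r - k = 1 + t * (q choose 2)] (mod r)"
  shows "N_Aut G > 0"
proof (rule N_Aut_pos)
  show "finite (carrier G)"
    using order q_pos r_pos by (simp add: order_gt_0_iff_finite[symmetric])
  show "(y [^] k, y) \<in> Q_Aut_conj G"
    unfolding Q_Aut_conj_iff using y generate_coprime_pow[OF y y_pow k(1)]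
    by (intro conjI bexI[OF _ id_in_auto]) simp_all
  show "(y [^] k, y) \<notin> R_Aut_conj G"
  proof
    assume "(y [^] k, y) \<in> R_Aut_conj G"
    then obtain f where f: "f \<in> auto G" "y [^] k = f y \<or> y [^] k = inv (f y)"
      using y by (auto simp: R_Aut_conj_iff auto_inv)
    from f(2) show False
    proof
      assume "y [^] k = f y"
      then show False
        using auto_pow_cong[OF f(1)] no_cong(1) by metis
    next
      assume "y [^] k = inv (f y)"
      moreover have "y [^] (r - k) \<otimes> y [^] k = \<one>"
        using k(2) y y_pow by (simp add: nat_pow_mult)
      ultimately have "f y = y [^] (r - k)"
        using y auto_closed[OF f(1) y] by (metis inv_equality inv_inv nat_pow_closed)
      then show False
        using auto_pow_cong[OF f(1)] no_cong(2) by metis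
    qed
  qed
qed

end


section \<open>Generators of a group with the given presentation\<close>

text \<open>This turns relations written with \<open>replicate\<close> into equations between
  powers.\<close>

lemma presented_group_pow:
  "(word_cong R `` {[p]}) [^]\<^bsub>presented_group R\<^esub> (n::nat) = word_cong R `` {replicate n p}"
proof -
  interpret P: group "presented_group R"
    by (rule group_presented_group)
  show ?thesis
  proof (induction n)
    case 0
    then show ?case by (simp add: presented_group_def)
  next
    case (Suc n)
    then show ?case
      by (simp add: presented_group_mult replicate_append_same)
  qed
qed

lemma class_eqI: "(u, v) \<in> word_cong R \<Longrightarrow> word_cong R `` {u} = word_cong R `` {v}"
  by (rule equiv_class_eq[OF equiv_word_cong])

text \<open>A formal inverse letter represents the inverse of its generator by
  \<open>word_cong.cancel\<close>, and every word is a product of letters.\<close>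

lemma generate_presented_group:
  "generate (presented_group R) (range (\<lambda>c. word_cong R `` {[(c, True)]}))
    = carrier (presented_group R)" (is "generate ?P ?K = _")
proof
  interpret P: group ?P
    by (rule group_presented_group)
  have cl: "word_cong R `` {w} \<in> carrier ?P" for w
    by (auto simp: presented_group_def quotient_def)
  then show "generate ?P ?K \<subseteq> carrier ?P"
    by (intro P.generate_incl) auto
  have letter: "word_cong R `` {[(c, s)]} \<in> generate ?P ?K" for c s
  proof (cases s)
    case True
    then show ?thesis by (auto intro: generate.incl)
  next
    case False
    have "(word_cong R `` {[(c, False)]}) \<otimes>\<^bsub>?P\<^esub> (word_cong R `` {[(c, True)]}) = \<one>\<^bsub>?P\<^esub>"
      using class_eqI[OF word_cong.cancel[of "[]" c False "[]" R]]
      by (simp add: presented_group_mult) (simp add: presented_group_def)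
    then have "inv\<^bsub>?P\<^esub> (word_cong R `` {[(c, True)]}) = word_cong R `` {[(c, False)]}"
      by (intro P.inv_equality cl)
    then show ?thesis
      using generate.inv[of "word_cong R `` {[(c, True)]}" ?K ?P] False by auto
  qed
  have "word_cong R `` {w} \<in> generate ?P ?K" for w
  proof (induction w)
    case Nil
    then show ?case
      using generate.one[of ?P ?K] by (simp add: presented_group_def)
  next
    case (Cons p w)
    then show ?case
      using generate.eng[OF letter[of "fst p" "snd p"] Cons.IH] by (simp add: presented_group_mult)
  qed
  then show "carrier ?P \<subseteq> generate ?P ?K"
    by (auto simp: presented_group_def quotient_def)
qed

text \<open>The generators are the images of the two letter classes under an isomorphism from the
  presented group, which carries the relations over.\<close>

lemma qr_group_presentation:
  fixes G (structure)
  assumes "0 < q" "r dvd q" and G: "group G" and "order G = q * r\<^sup>2"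
    and "G \<cong> presented_group (relations_qr q r)"
  obtains x y where "qr_group G q r x y"
proof -
  let ?R = "relations_qr q r"
  let ?P = "presented_group ?R"
  let ?C = "\<lambda>w. word_cong ?R `` {w}"
  interpret P: group ?P
    by (rule group_presented_group)
  obtain h where h: "h \<in> iso ?P G"
    using group.iso_sym[OF G assms(5)] by (auto simp: is_iso_def)
  interpret h: group_hom ?P G h
    using h G by (simp add: group_hom_def group_hom_axioms_def P.is_group iso_def)
  let ?x = "?C [(gen.a, True)]" and ?y = "?C [(gen.b, True)]"
  have cl: "?C w \<in> carrier ?P" for w
    by (auto simp: presented_group_def quotient_def)
  have one: "\<one>\<^bsub>?P\<^esub> = ?C []"
    by (simp add: presented_group_def)
  have rel: "?C u = ?C v" if "(u, v) \<in> ?R" for u v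
    using class_eqI[OF word_cong.relation[OF that, of "[]" "[]"]] by simp
  have x_pow: "?x [^]\<^bsub>?P\<^esub> (q * r) = \<one>\<^bsub>?P\<^esub>"
    unfolding presented_group_pow one by (rule rel) (simp add: relations_qr_def)
  have y_pow: "?y [^]\<^bsub>?P\<^esub> r = \<one>\<^bsub>?P\<^esub>"
    unfolding presented_group_pow one by (rule rel) (simp add: relations_qr_def)
  have yx: "?y \<otimes>\<^bsub>?P\<^esub> ?x = ?x [^]\<^bsub>?P\<^esub> q \<otimes>\<^bsub>?P\<^esub> ?x \<otimes>\<^bsub>?P\<^esub> ?y"
  proof -
    \<comment> \<open>Inserting a cancelling pair of letters \<open>b\<close> at the end exposes the
      left side of the conjugation relation.\<close>
    have "?y \<otimes>\<^bsub>?P\<^esub> ?x = ?C ([(gen.b, True), (gen.a, True)] @ [(gen.b, False), (gen.b, True)] @ [])"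
      using class_eqI[OF word_cong.cancel[of "[(gen.b, True), (gen.a, True)]" gen.b False "[]" ?R]]
      by (simp add: presented_group_mult)
    also have "\<dots> = ?C [(gen.b, True), (gen.a, True), (gen.b, False)] \<otimes>\<^bsub>?P\<^esub> ?y"
      by (simp add: presented_group_mult)
    also have "?C [(gen.b, True), (gen.a, True), (gen.b, False)] = ?x [^]\<^bsub>?P\<^esub> (q + 1)"
      unfolding presented_group_pow by (rule rel) (simp add: relations_qr_def)
    finally show ?thesis
      by simp
  qed
  have "generate G {h ?x, h ?y} = h ` generate ?P {?x, ?y}"
    using h.generate_img[of "{?x, ?y}"] cl by simp
  also have "{?x, ?y} = range (\<lambda>c. ?C [(c, True)])"
  proof -
    have UNIV: "(UNIV :: gen set) = {gen.a, gen.b}"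
      by (rule UNIV_eq_I) (metis gen.exhaust insertCI)
    show ?thesis
      unfolding UNIV by simp
  qed
  also have "h ` generate ?P \<dots> = carrier G"
    using h by (simp only: generate_presented_group) (simp add: iso_iff)
  finally have gen: "generate G {h ?x, h ?y} = carrier G" .
  have "qr_group G q r (h ?x) (h ?y)"
  proof (intro qr_group.intro qr_group_axioms.intro)
    show "h ?x [^]\<^bsub>G\<^esub> (q * r) = \<one>\<^bsub>G\<^esub>" "h ?y [^]\<^bsub>G\<^esub> r = \<one>\<^bsub>G\<^esub>"
      by (simp_all add: cl x_pow y_pow flip: h.hom_nat_pow)
    show "h ?y \<otimes>\<^bsub>G\<^esub> h ?x = h ?x [^]\<^bsub>G\<^esub> q \<otimes>\<^bsub>G\<^esub> h ?x \<otimes>\<^bsub>G\<^esub> h ?y"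
      by (simp add: cl yx flip: h.hom_nat_pow h.hom_mult)
  qed (use assms gen cl in auto)
  then show thesis
    by (rule that)
qed


section \<open>Exponents\<close>

lemma exists_totative_not_pm_one:
  assumes "1 < r" "2 < totient r"
  obtains k where "coprime k r" "k < r" "\<not> [k = 1] (mod r)" "\<not> [r - k = 1] (mod r)"
proof -
  have "\<not> totatives r \<subseteq> {1, r - 1}"
    using card_mono[of "{1, r - 1}" "totatives r"] assms(2) card_insert_le_m1[of 2 "{r - 1}" 1]
    by (auto simp: totient_def)
  then obtain k where k: "k \<in> totatives r" "k \<noteq> 1" "k \<noteq> r - 1"
    by blast
  have "0 < k" "k < r" "coprime k r"
    using k(1) assms(1) totatives_less by (auto simp: in_totatives_iff)
  then show thesis
    using k(2,3) assms(1) by (intro that) (auto simp: cong_def)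
qed

text \<open>The number \<open>2 * k - 2\<close> is a multiple of \<open>r\<close> smaller than
  \<open>2 * r\<close>, hence 0 or \<open>r\<close>.\<close>

lemma double_cong_two_nat:
  fixes k r :: nat
  assumes "[2 * k = 2] (mod r)" "0 < k" "k < r"
  shows "k = 1 \<or> 2 * k = r + 2"
proof -
  have "r dvd 2 * k - 2"
    using assms by (simp add: cong_def mod_eq_dvd_iff_nat)
  then obtain c where c: "2 * k - 2 = r * c" ..
  have "c < 2"
  proof (rule ccontr)
    assume "\<not> c < 2"
    then have "r * 2 \<le> r * c" by simp
    then show False using c assms(2,3) by linarith
  qed
  then show ?thesis
    using c assms(2,3) by (cases c) auto
qed

lemma exists_totative_double_not_pm_two:
  assumes "1 < r" "4 < totient r"
  obtains k where "coprime k r" "k < r" "\<not> [2 * k = 2] (mod r)" "\<not> [2 * (r - k) = 2] (mod r)"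
proof -
  \<comment> \<open>The first and third entries cover the solutions of 2k = 2 modulo
    \<open>r\<close>, the other two those of 2k = -2. For odd \<open>r\<close> the rounded halves
    are excluded as well, which the bound of four allows for.\<close>
  let ?B = "{1, r - 1, (r + 2) div 2, (r - 2) div 2}"
  have "card ?B \<le> 4"
    by (simp add: card_insert_if)
  then have "\<not> totatives r \<subseteq> ?B"
    using card_mono[of ?B "totatives r"] assms(2) by (auto simp: totient_def)
  then obtain k where k: "k \<in> totatives r" "k \<notin> ?B"
    by blast
  have k': "0 < k" "k < r" "coprime k r"
    using k(1) assms(1) totatives_less by (auto simp: in_totatives_iff)
  show thesis
  proof (rule that)
    show "\<not> [2 * k = 2] (mod r)"
      using double_cong_two_nat[of k r] k(2) k' by auto
    show "\<not> [2 * (r - k) = 2] (mod r)"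
    proof
      assume "[2 * (r - k) = 2] (mod r)"
      then have "r - k = 1 \<or> 2 * (r - k) = r + 2"
        using k' by (intro double_cong_two_nat) auto
      then have "k = r - 1 \<or> 2 * k = r - 2"
        using k' by linarith
      then show False
        using k(2) by auto
    qed
  qed (use k' in auto)
qed

text \<open>In \<open>q * (q - 1) div 2\<close> the 2 is absorbed by \<open>q - 1\<close> if
  \<open>q\<close> is odd; otherwise half of \<open>q\<close> is still a multiple of
  \<open>r\<close>.\<close>

lemma dvd_choose_two:
  fixes q r :: nat
  assumes "r dvd q" "odd q \<or> 2 * r dvd q"
  shows "r dvd (q choose 2)"
proof (cases "odd q")
  case True
  then have "q choose 2 = q * ((q - 1) div 2)"
    by (simp add: choose_two div_mult_swap)
  then show ?thesis
    using assms(1) by simp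
next
  case False
  then obtain c where "q = 2 * r * c"
    using assms(2) by (auto elim!: dvdE)
  then have "q choose 2 = r * (c * (q - 1))"
    by (simp add: choose_two)
  then show ?thesis by simp
qed

theorem mainTheorem5:
  fixes G :: "('g, 'm) monoid_scheme" and q r :: nat
  assumes "0 < q" and "1 < r" and "r dvd q"
    and "group G" and "order G = q * r\<^sup>2"
    and "G \<cong> presented_group (relations_qr q r)"
    and "totient r > 4 \<or> (totient r = 4 \<and> (odd q \<or> 2 * r dvd q))"
  shows "N_Aut G > 0"
proof -
  obtain x y where "qr_group G q r x y"
    using qr_group_presentation assms(1,3-6) by blast
  then interpret qr_group G q r x y .
  show ?thesis
  \<comment> \<open>In the first case the term with \<open>t\<close> vanishes modulo
    \<open>r\<close>, so avoiding 1 and -1 suffices. In the second it vanishes only after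
    doubling.\<close>
  proof (cases "r dvd (q choose 2)")
    case True
    obtain k where k: "coprime k r" "k < r" "\<not> [k = 1] (mod r)" "\<not> [r - k = 1] (mod r)"
    proof (rule exists_totative_not_pm_one[OF assms(2)])
      show "2 < totient r"
        using assms(7) by auto
    qed
    have *: "[1 + t * (q choose 2) = 1] (mod r)" for t
      using True cong_add_lcancel_0_nat[of 1 "t * (q choose 2)" r] by (simp add: cong_0_iff)
    show ?thesis
      using N_Aut_pos_if[OF k(1,2)] k(3,4) cong_trans[OF _ *] by blast
  next
    case False
    \<comment> \<open>When \<open>totient r = 4\<close>, the parity condition on \<open>q\<close>
      leads to the first case.\<close>
    then have "4 < totient r"
      using dvd_choose_two assms(3,7) by blast
    with assms(2) obtain k where k: "coprime k r" "k < r"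
        "\<not> [2 * k = 2] (mod r)" "\<not> [2 * (r - k) = 2] (mod r)"
      by (rule exists_totative_double_not_pm_two)
    have *: "[2 * j = 2] (mod r)" if "[j = 1 + t * (q choose 2)] (mod r)" for j t
    proof -
      \<comment> \<open>Doubling clears the denominator of the binomial coefficient, leaving a
        multiple of \<open>q\<close> and hence of \<open>r\<close>.\<close>
      have "2 * (q choose 2) = q * (q - 1)"
        unfolding choose_two by (rule dvd_mult_div_cancel) auto
      then have "2 * (1 + t * (q choose 2)) = 2 + t * (q * (q - 1))"
        by (simp only: distrib_left mult.left_commute[of 2 t] mult_1_right)
      moreover have "[2 + t * (q * (q - 1)) = 2] (mod r)"
        unfolding cong_add_lcancel_0_nat using assms(3) by (simp add: cong_0_iff)
      ultimately show ?thesis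
        using cong_scalar_left[OF that, of 2] by (metis cong_trans)
    qed
    show ?thesis
      using N_Aut_pos_if[OF k(1,2)] k(3,4) * by blast
  qed
qed

end
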